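(* Let $\mathcal{A}=\bigcup_\alpha X_\alpha$ be a unital strong algebra and let $a\in\mathcal{A}$ be such that there exist $\alpha,\beta$ with $\beta\ge h(\alpha)$ and $A_{\beta,\alpha}\|a\|_\alpha<1$. Then $1-a$ is invertible (from both sides) and it holds that $$\|(1-a)^{-1}\|_\beta\le\frac{\|1\|_\beta}{1-A_{\beta,\alpha}\|a\|_\alpha},\qquad \|1-(1-a)^{-1}\|_\beta\le\frac{A_{\beta,\alpha}\|a\|_\alpha\|1\|_\beta}{1-A_{\beta,\alpha}\|a\|_\alpha},$$ where $$(1-a)^{-1}=\sum_{n=0}^\infty a^n.$$
   Context: Inductive limit of Banach spaces: a vector space $X$ with a family $\{X_\alpha:\alpha\in A\}$ of subspaces, $X_\alpha\ne X_\beta$ for $\alpha\neq\beta$, directed under inclusion, with $X=\bigcup_\alpha X_\alpha$; the index set $A$ is directed by $\alpha\le\beta$ iff $X_\alpha\subseteq X_\beta$. Each $X_\alpha$ is a Banach space with norm $\|\cdot\|_\alpha$, and whenever $\alpha\le\beta$ the topology induced by $\|\cdot\|_\beta$ on $X_\alpha$ is coarser than that induced by $\|\cdot\|_\alpha$. $X$ carries the inductive limit topology: the finest locally convex topology making all inclusions $X_\alpha\hookrightarrow X$ continuous. Strong algebra: an inductive limit $\mathcal{A}=\bigcup_{\alpha\in A} X_\alpha$ of Banach spaces which is also an algebra such that for any $\alpha\in A$ there exists $h(\alpha)\in A$ such that for any $\beta\ge h(\alpha)$ there is a positive constant $A_{\beta,\alpha}$ with $\|ab\|_\beta\le A_{\beta,\alpha}\|a\|_\alpha\|b\|_\beta$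 and $\|ba\|_\beta\le A_{\beta,\alpha}\|a\|_\alpha\|b\|_\beta$ for every $a\in X_\alpha$, $b\in X_\beta$. The map $h$ and the constants $A_{\beta,\alpha}$ are those of this definition. Unital means that $\mathcal{A}$ has a multiplicative unit $1$.
   Formalization: The unit 1 is assumed to lie in X_β, so that ‖1‖_β is defined; without this the claim fails, e.g. X_1={0}, X_2 a unital Banach algebra, h constantly 1, A_{1,2} small, α=2, β=1, a=1, where 1−a=0. *)

theory Defs
  imports "HOL-Analysis.Analysis"
begin

text \<open>
  The scalar field is an arbitrary type of class \<open>real_normed_field\<close>. The norm of such a type is
  multiplicative, so up to isometric isomorphism it is the field of real or of complex numbers.
  A vector space is given by its scalar multiplication \<open>smul\<close> on an abelian group, so that one
  and the same type can be equipped with either kind of structure.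
\<close>

section \<open>Banach spaces carried by a subspace\<close>

text \<open>
  A norm on a subspace \<open>V\<close> is a function on the whole type whose values outside \<open>V\<close> are
  irrelevant. The distance is cut off outside \<open>V\<close>, because the library locale \<open>Metric_space\<close>
  asks for nonnegativity and symmetry on the whole type.
\<close>

definition norm_dist :: "'a::ab_group_add set \<Rightarrow> ('a \<Rightarrow> real) \<Rightarrow> 'a \<Rightarrow> 'a \<Rightarrow> real" where
  "norm_dist V N x y = (if x \<in> V \<and> y \<in> V then N (x - y) else 0)"

definition norm_topology :: "'a::ab_group_add set \<Rightarrow> ('a \<Rightarrow> real) \<Rightarrow> 'a topology" where
  "norm_topology V N = Metric_space.mtopology V (norm_dist V N)"

locale banach_subspace = vector_space smul
  for smul :: "'k::real_normed_field \<Rightarrow> 'a::ab_group_add \<Rightarrow> 'a" +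
  fixes V :: "'a set" and N :: "'a \<Rightarrow> real"
  assumes is_subspace: "module.subspace smul V"
    and norm_nonneg: "x \<in> V \<Longrightarrow> 0 \<le> N x"
    and norm_eq_zero: "x \<in> V \<Longrightarrow> N x = 0 \<longleftrightarrow> x = 0"
    and norm_scale: "x \<in> V \<Longrightarrow> N (smul c x) = norm c * N x"
    and norm_triangle: "x \<in> V \<Longrightarrow> y \<in> V \<Longrightarrow> N (x + y) \<le> N x + N y"
    and complete: "Metric_space.mcomplete V (norm_dist V N)"
begin

lemma norm_minus_commute: "x \<in> V \<Longrightarrow> y \<in> V \<Longrightarrow> N (x - y) = N (y - x)"
  using norm_scale[of "y - x" "-1"] subspace_diff[OF is_subspace, of y x]
  by (simp add: scale_minus_left)

lemma Metric_space_norm_dist: "Metric_space V (norm_dist V N)"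
proof
  show "0 \<le> norm_dist V N x y" for x y
    using norm_nonneg subspace_diff[OF is_subspace] by (simp add: norm_dist_def)
  show "norm_dist V N x y = norm_dist V N y x" for x y
    using norm_minus_commute by (simp add: norm_dist_def)
  show "norm_dist V N x y = 0 \<longleftrightarrow> x = y" if "x \<in> V" "y \<in> V" for x y
    using that norm_eq_zero subspace_diff[OF is_subspace] by (simp add: norm_dist_def)
  show "norm_dist V N x z \<le> norm_dist V N x y + norm_dist V N y z"
    if "x \<in> V" "y \<in> V" "z \<in> V" for x y z
    using that norm_triangle[of "x - y" "y - z"] subspace_diff[OF is_subspace]
    by (simp add: norm_dist_def)
qed

end

section \<open>Locally convex topologies\<close>

definition convex_wrt :: "('k::real_normed_field \<Rightarrow> 'a::ab_group_add \<Rightarrow> 'a) \<Rightarrow> 'a set \<Rightarrow> bool" where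
  "convex_wrt smul C \<longleftrightarrow>
    (\<forall>x\<in>C. \<forall>y\<in>C. \<forall>u\<ge>0. \<forall>v\<ge>0. u + v = 1 \<longrightarrow>
      smul (of_real u) x + smul (of_real v) y \<in> C)"

text \<open>The Hausdorff property is not required.\<close>

definition locally_convex_topology ::
    "('k::real_normed_field \<Rightarrow> 'a::ab_group_add \<Rightarrow> 'a) \<Rightarrow> 'a topology \<Rightarrow> bool" where
  "locally_convex_topology smul T \<longleftrightarrow>
    topspace T = UNIV \<and>
    continuous_map (prod_topology T T) T (\<lambda>(x, y). x + y) \<and>
    continuous_map (prod_topology euclidean T) T (\<lambda>(c, x). smul c x) \<and>
    (\<forall>U. openin T U \<and> 0 \<in> U \<longrightarrow>
      (\<exists>W C. openin T W \<and> 0 \<in> W \<and> W \<subseteq> C \<and> C \<subseteq> U \<and> convex_wrt smul C))"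

definition inclusions_continuous ::
    "'i set \<Rightarrow> ('i \<Rightarrow> 'a::ab_group_add set) \<Rightarrow> ('i \<Rightarrow> 'a \<Rightarrow> real) \<Rightarrow> 'a topology \<Rightarrow> bool" where
  "inclusions_continuous I X N T \<longleftrightarrow>
    (\<forall>\<alpha>\<in>I. continuous_map (norm_topology (X \<alpha>) (N \<alpha>)) T (\<lambda>x. x))"

text \<open>
  The finest locally convex topology making the inclusions continuous is constructed as the
  supremum of all such topologies; that it is itself one of them, and hence the finest, is the
  lemma \<open>ind_lim_topology_finest\<close> below.
\<close>

definition ind_lim_topology ::
    "('k::real_normed_field \<Rightarrow> 'a::ab_group_add \<Rightarrow> 'a) \<Rightarrow> 'i set \<Rightarrow> ('i \<Rightarrow> 'a set) \<Rightarrow>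
      ('i \<Rightarrow> 'a \<Rightarrow> real) \<Rightarrow> 'a topology" where
  "ind_lim_topology smul I X N =
    topology_generated_by
      {U. \<exists>T. locally_convex_topology smul T \<and> inclusions_continuous I X N T \<and> openin T U}"

lemma openin_indiscrete:
  "openin (topology (\<lambda>U. U = {} \<or> U = UNIV)) U \<longleftrightarrow> U = {} \<or> U = UNIV"
proof -
  have "istopology (\<lambda>U::'a set. U = {} \<or> U = UNIV)"
    by (auto simp: istopology_def)
  then show ?thesis
    by (simp add: topology_inverse')
qed

lemma topspace_indiscrete: "topspace (topology (\<lambda>U. U = {} \<or> U = UNIV)) = UNIV"
  by (metis openin_indiscrete openin_subset subset_antisym top_greatest)

lemma continuous_map_indiscrete: "continuous_map S (topology (\<lambda>U. U = {} \<or> U = UNIV)) f"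
proof -
  have "openin S {x \<in> topspace S. f x \<in> U}" if "U = {} \<or> U = UNIV" for U
    using that by auto
  then show ?thesis
    by (simp add: continuous_map_def openin_indiscrete topspace_indiscrete)
qed

lemma indiscrete_locally_convex:
  "locally_convex_topology smul (topology (\<lambda>U. U = {} \<or> U = UNIV))"
  "inclusions_continuous I X N (topology (\<lambda>U. U = {} \<or> U = UNIV))"
  by (auto simp: locally_convex_topology_def inclusions_continuous_def convex_wrt_def
      topspace_indiscrete continuous_map_indiscrete openin_indiscrete)

lemma continuous_map_into_ind_lim:
  assumes "\<And>T. locally_convex_topology smul T \<Longrightarrow> inclusions_continuous I X N T \<Longrightarrow>
    continuous_map S T f"
  shows "continuous_map S (ind_lim_topology smul I X N) f"
  unfolding ind_lim_topology_def
proof (rule continuous_on_generated_topo)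
  let ?B = "{U. \<exists>T. locally_convex_topology smul T \<and> inclusions_continuous I X N T \<and> openin T U}"
  have "UNIV \<in> ?B"
    using indiscrete_locally_convex openin_indiscrete by blast
  then show "f ` topspace S \<subseteq> \<Union>?B"
    by blast
  show "openin S (f -` U \<inter> topspace S)" if "U \<in> ?B" for U
  proof -
    from that obtain T where "openin T U" "continuous_map S T f"
      using assms by blast
    then have "openin S {x \<in> topspace S. f x \<in> U}"
      by (simp add: continuous_map_def)
    then show ?thesis
      by (simp add: vimage_def Int_def conj_commute)
  qed
qed

theorem ind_lim_topology_finest:
  "locally_convex_topology smul (ind_lim_topology smul I X N)"
  "inclusions_continuous I X N (ind_lim_topology smul I X N)"
  "locally_convex_topology smul T \<Longrightarrow> inclusions_continuous I X N T \<Longrightarrow> openin T U \<Longrightarrow>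
    openin (ind_lim_topology smul I X N) U"
proof -
  let ?P = "\<lambda>T. locally_convex_topology smul T \<and> inclusions_continuous I X N T"
  let ?B = "{U. \<exists>T. ?P T \<and> openin T U}"
  let ?J = "ind_lim_topology smul I X N"
  have J: "?J = topology_generated_by ?B"
    by (simp add: ind_lim_topology_def)
  have fine: "openin ?J U" if "?P T" "openin T U" for T U
    unfolding J by (rule topology_generated_by_Basis) (use that in auto)
  then show "locally_convex_topology smul T \<Longrightarrow> inclusions_continuous I X N T \<Longrightarrow> openin T U \<Longrightarrow>
      openin ?J U" for T U by blast
  have topT: "topspace T = UNIV" if "?P T" for T
    using that by (simp add: locally_convex_topology_def)
  have BU: "\<Union>?B = UNIV"
  proof -
    obtain T where T: "?P T"
      using indiscrete_locally_convex by blast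
    then have "openin T UNIV"
      by (metis topT openin_topspace)
    with T show ?thesis by blast
  qed
  then have topJ: "topspace ?J = UNIV"
    unfolding J by simp
  have idJ: "continuous_map ?J T (\<lambda>x. x)" if "?P T" for T
    using fine[OF that] topT[OF that] topJ by (simp add: continuous_map_def)
  show "inclusions_continuous I X N ?J"
    unfolding inclusions_continuous_def
  proof
    fix \<alpha> assume "\<alpha> \<in> I"
    then show "continuous_map (norm_topology (X \<alpha>) (N \<alpha>)) ?J (\<lambda>x. x)"
      by (intro continuous_map_into_ind_lim) (simp add: inclusions_continuous_def)
  qed
  have add: "continuous_map (prod_topology ?J ?J) ?J (\<lambda>(x, y). x + y)"
  proof (rule continuous_map_into_ind_lim)
    fix T assume "locally_convex_topology smul T" "inclusions_continuous I X N T"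
    then have T: "?P T" ..
    have "continuous_map (prod_topology ?J ?J) (prod_topology T T) (\<lambda>p. (fst p, snd p))"
      by (intro continuous_map_pairedI continuous_map_compose[OF continuous_map_fst idJ[OF T], unfolded o_def]
          continuous_map_compose[OF continuous_map_snd idJ[OF T], unfolded o_def])
    moreover have "continuous_map (prod_topology T T) T (\<lambda>(x, y). x + y)"
      using T by (simp add: locally_convex_topology_def)
    ultimately show "continuous_map (prod_topology ?J ?J) T (\<lambda>(x, y). x + y)"
      by (auto dest: continuous_map_compose simp: o_def)
  qed
  have scl: "continuous_map (prod_topology euclidean ?J) ?J (\<lambda>(c, x). smul c x)"
  proof (rule continuous_map_into_ind_lim)
    fix T assume "locally_convex_topology smul T" "inclusions_continuous I X N T"
    then have T: "?P T" ..
    have "continuous_map (prod_topology euclidean ?J) (prod_topology euclidean T) (\<lambda>p. (fst p, snd p))"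
      by (intro continuous_map_pairedI continuous_map_fst
          continuous_map_compose[OF continuous_map_snd idJ[OF T], unfolded o_def])
    moreover have "continuous_map (prod_topology euclidean T) T (\<lambda>(c, x). smul c x)"
      using T by (simp add: locally_convex_topology_def)
    ultimately show "continuous_map (prod_topology euclidean ?J) T (\<lambda>(c, x). smul c x)"
      by (auto dest: continuous_map_compose simp: o_def)
  qed
  let ?L = "\<lambda>U. \<exists>W C. openin ?J W \<and> 0 \<in> W \<and> W \<subseteq> C \<and> C \<subseteq> U \<and> convex_wrt smul C"
  have loc: "0 \<in> U \<longrightarrow> ?L U" if "generate_topology_on ?B U" for U
    using that
  proof induction
    case Empty
    then show ?case by simp
  next
    case (Int U1 U2)
    show ?case
    proof
      assume "0 \<in> U1 \<inter> U2"
      with Int obtain W1 C1 W2 C2 where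
        1: "openin ?J W1" "0 \<in> W1" "W1 \<subseteq> C1" "C1 \<subseteq> U1" "convex_wrt smul C1" and
        2: "openin ?J W2" "0 \<in> W2" "W2 \<subseteq> C2" "C2 \<subseteq> U2" "convex_wrt smul C2"
        by blast
      show "?L (U1 \<inter> U2)"
        by (rule exI[of _ "W1 \<inter> W2"], rule exI[of _ "C1 \<inter> C2"])
          (use 1 2 in \<open>auto simp: convex_wrt_def openin_Int\<close>)
    qed
  next
    case (UN K)
    then show ?case by (meson UnionE Union_upper order_trans)
  next
    case (Basis U)
    then obtain T where T: "?P T" "openin T U" by blast
    then show ?case
      using fine[OF T(1)] unfolding locally_convex_topology_def by meson
  qed
  show "locally_convex_topology smul ?J"
    unfolding locally_convex_topology_def
    using topJ add scl loc by (auto simp: J openin_topology_generated_by_iff)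
qed

section \<open>Inductive limits of Banach spaces and strong algebras\<close>

text \<open>
  The index set \<open>I\<close> is ordered by inclusion of the subspaces \<open>X \<alpha>\<close>, i.e. \<open>\<alpha> \<le> \<beta>\<close> means
  \<open>X \<alpha> \<subseteq> X \<beta>\<close>; the whole type \<open>'a\<close> is the inductive limit, with the topology
  \<open>ind_lim_topology smul I X N\<close>.
\<close>

locale inductive_limit_banach = vector_space smul
  for smul :: "'k::real_normed_field \<Rightarrow> 'a::ab_group_add \<Rightarrow> 'a" +
  fixes I :: "'i set" and X :: "'i \<Rightarrow> 'a set" and N :: "'i \<Rightarrow> 'a \<Rightarrow> real"
  assumes banach: "\<alpha> \<in> I \<Longrightarrow> banach_subspace smul (X \<alpha>) (N \<alpha>)"
    and distinct: "inj_on X I"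
    and directed: "\<alpha> \<in> I \<Longrightarrow> \<beta> \<in> I \<Longrightarrow> \<exists>\<gamma>\<in>I. X \<alpha> \<subseteq> X \<gamma> \<and> X \<beta> \<subseteq> X \<gamma>"
    and exhaust: "(\<Union>\<alpha>\<in>I. X \<alpha>) = UNIV"
    and coarser: "\<alpha> \<in> I \<Longrightarrow> \<beta> \<in> I \<Longrightarrow> X \<alpha> \<subseteq> X \<beta> \<Longrightarrow>
      openin (subtopology (norm_topology (X \<beta>) (N \<beta>)) (X \<alpha>)) U \<Longrightarrow>
      openin (norm_topology (X \<alpha>) (N \<alpha>)) U"

text \<open>
  The algebra is associative, and need not be unital. \<open>K \<beta> \<alpha>\<close> is the constant
  $A_{\beta,\alpha}$; it is only meaningful for \<open>\<beta> \<ge> h \<alpha>\<close>. The norm inequalities include that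
  the products lie in \<open>X \<beta>\<close>, as otherwise their norms would not be defined.
\<close>

locale strong_algebra = inductive_limit_banach smul I X N
  for smul :: "'k::real_normed_field \<Rightarrow> 'a::ring \<Rightarrow> 'a"
    and I :: "'i set" and X :: "'i \<Rightarrow> 'a set" and N :: "'i \<Rightarrow> 'a \<Rightarrow> real" +
  fixes h :: "'i \<Rightarrow> 'i" and K :: "'i \<Rightarrow> 'i \<Rightarrow> real"
  assumes scale_mult_left: "smul c x * y = smul c (x * y)"
    and scale_mult_right: "x * smul c y = smul c (x * y)"
    and h_in: "\<alpha> \<in> I \<Longrightarrow> h \<alpha> \<in> I"
    and K_pos: "\<alpha> \<in> I \<Longrightarrow> \<beta> \<in> I \<Longrightarrow> X (h \<alpha>) \<subseteq> X \<beta> \<Longrightarrow> 0 < K \<beta> \<alpha>"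
    and mult_left: "\<alpha> \<in> I \<Longrightarrow> \<beta> \<in> I \<Longrightarrow> X (h \<alpha>) \<subseteq> X \<beta> \<Longrightarrow> a \<in> X \<alpha> \<Longrightarrow> b \<in> X \<beta> \<Longrightarrow>
      a * b \<in> X \<beta> \<and> N \<beta> (a * b) \<le> K \<beta> \<alpha> * N \<alpha> a * N \<beta> b"
    and mult_right: "\<alpha> \<in> I \<Longrightarrow> \<beta> \<in> I \<Longrightarrow> X (h \<alpha>) \<subseteq> X \<beta> \<Longrightarrow> a \<in> X \<alpha> \<Longrightarrow> b \<in> X \<beta> \<Longrightarrow>
      b * a \<in> X \<beta> \<and> N \<beta> (b * a) \<le> K \<beta> \<alpha> * N \<alpha> a * N \<beta> b"

end

theory Submission
  imports Defs
begin

text \<open>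
  Because \<open>\<beta>\<close> lies above \<open>h \<alpha>\<close>, left multiplication by \<open>a\<close> maps the Banach space
  \<open>X \<beta>\<close> into itself and shrinks the norm at least by the factor
  \<open>q = K \<beta> \<alpha> * N \<alpha> a < 1\<close>, and so does right multiplication. Hence \<open>x \<mapsto> 1 + a * x\<close>
  and \<open>x \<mapsto> 1 + x * a\<close> are contractions of \<open>X \<beta>\<close>, and Banach's theorem
  (\<open>affine_contraction_fixpoint\<close>) gives fixed points: a right inverse \<open>b\<close> and a left inverse
  \<open>c\<close> of \<open>1 - a\<close>, which must coincide.

  Everything else follows from \<open>b = 1 + a * b\<close>. Taking norms gives
  \<open>N \<beta> b \<le> N \<beta> 1 + q * N \<beta> b\<close>, which is the first estimate, and \<open>1 - b = - (a * b)\<close>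
  gives the second. Iterating the equation \<open>m\<close> times, one finds that \<open>a ^ m * b\<close>, of norm at
  most \<open>q ^ m * N \<beta> b\<close>, is exactly what the partial sum of the first \<open>m\<close> powers misses from
  \<open>b\<close> (\<open>geometric_sum_eq_diff\<close>). So the series converges to \<open>b\<close> in \<open>X \<beta>\<close>, and the
  continuity of the inclusion carries this over to the inductive limit.

  Obtaining \<open>b\<close> as a fixed point rather than as the sum of the series spares the proof that the
  partial sums form a Cauchy sequence, and any passage to the limit in a product.
\<close>

lemma (in banach_subspace) norm_uminus:
  assumes "x \<in> V" shows "N (- x) = N x"
  using norm_scale[OF assms, of "-1"] by (simp add: scale_minus_left)

lemma (in banach_subspace) limitin_norm_topology_if_bound:
  assumes b: "b \<in> V" and s: "\<And>m. s m \<in> V"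
    and bound: "\<And>m. N (s m - b) \<le> r m" and r: "r \<longlonglongrightarrow> 0"
  shows "limitin (norm_topology V N) s b sequentially"
proof -
  interpret M: Metric_space V "norm_dist V N"
    by (rule Metric_space_norm_dist)
  have "(\<lambda>m. norm_dist V N (s m) b) \<longlonglongrightarrow> 0"
    by (rule tendsto_sandwich[OF _ _ tendsto_const r])
      (use b s bound in \<open>simp_all add: norm_dist_def norm_nonneg subspace_diff[OF is_subspace]\<close>)
  then show ?thesis
    unfolding norm_topology_def M.limitin_metric_dist_null using b s by simp
qed

text \<open>
  Since \<open>y + L x\<close> and \<open>y + L x'\<close> differ by \<open>L (x - x')\<close>, additivity and the bound make
  \<open>x \<mapsto> y + L x\<close> a contraction. The norm estimate is \<open>N b \<le> N y + q * N b\<close> solved for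
  \<open>N b\<close>.
\<close>

lemma (in banach_subspace) affine_contraction_fixpoint:
  assumes y: "y \<in> V"
    and L: "\<And>x. x \<in> V \<Longrightarrow> L x \<in> V"
    and diff: "\<And>x x'. x \<in> V \<Longrightarrow> x' \<in> V \<Longrightarrow> L (x - x') = L x - L x'"
    and bound: "\<And>x. x \<in> V \<Longrightarrow> N (L x) \<le> q * N x"
    and q: "q < 1"
  obtains b where "b \<in> V" "b - L b = y" "N b \<le> N y / (1 - q)"
proof -
  interpret M: Metric_space V "norm_dist V N"
    by (rule Metric_space_norm_dist)
  have maps: "y + L x \<in> V" if "x \<in> V" for x
    using subspace_add[OF is_subspace] y L that by blast
  have contr: "norm_dist V N (y + L x) (y + L x') \<le> q * norm_dist V N x x'"
    if "x \<in> V" "x' \<in> V" for x x'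
  proof -
    have "N (L (x - x')) \<le> q * N (x - x')"
      using bound subspace_diff[OF is_subspace] that by blast
    then show ?thesis
      using that maps by (simp add: norm_dist_def diff)
  qed
  have "V \<noteq> {}" "(\<lambda>x. y + L x) \<in> V \<rightarrow> V"
    using y maps by auto
  then obtain b where b: "b \<in> V" "y + L b = b"
    using M.Banach_fixedpoint_thm[OF complete _ _ q contr] by blast
  have "N b \<le> N y + N (L b)"
    using norm_triangle[OF y L[OF b(1)]] b(2) by simp
  also have "\<dots> \<le> N y + q * N b"
    using bound b(1) by simp
  finally have "N b * (1 - q) \<le> N y"
    by (simp add: algebra_simps)
  then have "N b \<le> N y / (1 - q)"
    using q by (simp add: pos_le_divide_eq)
  moreover have "b - L b = y"
    using b(2) by (metis add_diff_cancel_right')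
  ultimately show thesis
    using b(1) that by blast
qed

text \<open>
  The powers telescope when \<open>1\<close> is replaced by \<open>b - a * b\<close>: each \<open>a ^ n\<close> becomes
  \<open>a ^ n * b - a ^ Suc n * b\<close>. This exact remainder holds in any ring, so that convergence
  of the series only depends on the size of \<open>a ^ m * b\<close>.
\<close>

lemma geometric_sum_eq_diff:
  fixes a b :: "'a::ring_1"
  assumes "b - a * b = 1"
  shows "(\<Sum>n<m. a ^ n) = b - a ^ m * b"
proof (induction m)
  case 0
  show ?case by simp
next
  case (Suc m)
  have "a ^ m * b - a ^ Suc m * b = a ^ m * (b - a * b)"
    by (simp add: right_diff_distrib power_Suc2 mult.assoc del: power_Suc)
  also have "\<dots> = a ^ m"
    using assms by simp
  finally have step: "a ^ m * b - a ^ Suc m * b = a ^ m" .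
  have "(\<Sum>n<Suc m. a ^ n) = (b - a ^ m * b) + a ^ m"
    using Suc by simp
  also have "\<dots> = (b - a ^ m * b) + (a ^ m * b - a ^ Suc m * b)"
    by (simp only: step)
  finally show ?case
    by simp
qed

theorem proposition4p2:
  fixes smul :: "'k::real_normed_field \<Rightarrow> 'a::ring_1 \<Rightarrow> 'a"
    and I :: "'i set" and X :: "'i \<Rightarrow> 'a set" and N :: "'i \<Rightarrow> 'a \<Rightarrow> real"
    and h :: "'i \<Rightarrow> 'i" and K :: "'i \<Rightarrow> 'i \<Rightarrow> real"
    and a :: 'a and \<alpha> \<beta> :: 'i
  assumes "strong_algebra smul I X N h K"
    and "\<alpha> \<in> I" and "\<beta> \<in> I" and "X (h \<alpha>) \<subseteq> X \<beta>"
    and "a \<in> X \<alpha>" and "1 \<in> X \<beta>"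
    and "K \<beta> \<alpha> * N \<alpha> a < 1"
  shows "\<exists>b. (1 - a) * b = 1 \<and> b * (1 - a) = 1 \<and> b \<in> X \<beta> \<and>
    N \<beta> b \<le> N \<beta> 1 / (1 - K \<beta> \<alpha> * N \<alpha> a) \<and>
    N \<beta> (1 - b) \<le> K \<beta> \<alpha> * N \<alpha> a * N \<beta> 1 / (1 - K \<beta> \<alpha> * N \<alpha> a) \<and>
    limitin (norm_topology (X \<beta>) (N \<beta>)) (\<lambda>m. \<Sum>n<m. a ^ n) b sequentially \<and>
    limitin (ind_lim_topology smul I X N) (\<lambda>m. \<Sum>n<m. a ^ n) b sequentially"
proof -
  interpret strong_algebra smul I X N h K
    by fact
  interpret A: banach_subspace smul "X \<alpha>" "N \<alpha>"
    by (rule banach) fact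
  interpret B: banach_subspace smul "X \<beta>" "N \<beta>"
    by (rule banach) fact
  define q where "q = K \<beta> \<alpha> * N \<alpha> a"
  have q0: "0 \<le> q"
    unfolding q_def using K_pos A.norm_nonneg assms(2-5) by (simp add: less_imp_le)
  have q1: "q < 1"
    using assms(7) by (simp add: q_def)
  have ml: "a * x \<in> X \<beta>" "N \<beta> (a * x) \<le> q * N \<beta> x" if "x \<in> X \<beta>" for x
    using mult_left[OF assms(2-5) that] by (simp_all add: q_def)
  have mr: "x * a \<in> X \<beta>" "N \<beta> (x * a) \<le> q * N \<beta> x" if "x \<in> X \<beta>" for x
    using mult_right[OF assms(2-5) that] by (simp_all add: q_def)
  obtain b where b: "b \<in> X \<beta>" "b - a * b = 1" "N \<beta> b \<le> N \<beta> 1 / (1 - q)"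
    using B.affine_contraction_fixpoint[OF assms(6) ml(1) right_diff_distrib ml(2) q1] .
  obtain c where c: "c \<in> X \<beta>" "c - c * a = 1" "N \<beta> c \<le> N \<beta> 1 / (1 - q)"
    using B.affine_contraction_fixpoint[OF assms(6) mr(1) left_diff_distrib mr(2) q1] .
  have right: "(1 - a) * b = 1"
    using b(2) by (simp add: left_diff_distrib)
  have "c * (1 - a) = 1"
    using c(2) by (simp add: right_diff_distrib)
  moreover from this have "c = b"
    using right by (metis mult.assoc mult_1_left mult_1_right)
  ultimately have left: "b * (1 - a) = 1"
    by simp
  have "1 - b = (b - a * b) - b"
    by (simp only: b(2))
  then have "1 - b = - (a * b)"
    by simp
  then have "N \<beta> (1 - b) \<le> q * N \<beta> b"
    using ml[OF b(1)] B.norm_uminus by simp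
  also have "\<dots> \<le> q * (N \<beta> 1 / (1 - q))"
    using b(3) q0 by (rule mult_left_mono)
  finally have est: "N \<beta> (1 - b) \<le> q * N \<beta> 1 / (1 - q)"
    by simp
  have tail: "a ^ m * b \<in> X \<beta> \<and> N \<beta> (a ^ m * b) \<le> q ^ m * N \<beta> b" for m
  proof (induction m)
    case 0
    show ?case using b(1) by simp
  next
    case (Suc m)
    have "q * N \<beta> (a ^ m * b) \<le> q * (q ^ m * N \<beta> b)"
      using Suc q0 by (blast intro: mult_left_mono)
    then show ?case
      using ml[of "a ^ m * b"] Suc by (simp add: mult.assoc)
  qed
  have lim: "limitin (norm_topology (X \<beta>) (N \<beta>)) (\<lambda>m. \<Sum>n<m. a ^ n) b sequentially"
  proof (rule B.limitin_norm_topology_if_bound[OF b(1)])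
    show "(\<Sum>n<m. a ^ n) \<in> X \<beta>" for m
      using tail b(1) subspace_diff[OF B.is_subspace]
      by (simp add: geometric_sum_eq_diff[OF b(2)])
    show "N \<beta> ((\<Sum>n<m. a ^ n) - b) \<le> q ^ m * N \<beta> b" for m
      using tail[of m] B.norm_uminus by (simp add: geometric_sum_eq_diff[OF b(2)])
    show "(\<lambda>m. q ^ m * N \<beta> b) \<longlonglongrightarrow> 0"
      using q0 q1 by (intro tendsto_mult_left_zero LIMSEQ_power_zero) simp
  qed
  have "continuous_map (norm_topology (X \<beta>) (N \<beta>)) (ind_lim_topology smul I X N) (\<lambda>x. x)"
    using ind_lim_topology_finest(2)[where smul = smul and I = I and X = X and N = N] assms(3)
    by (simp add: inclusions_continuous_def)
  from continuous_map_limit[OF this lim]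
  have "limitin (ind_lim_topology smul I X N) (\<lambda>m. \<Sum>n<m. a ^ n) b sequentially"
    by (simp add: o_def)
  with left right b est lim show ?thesis
    unfolding q_def by blast
qed

end
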